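(* Let $n>1$, $d>1$ be integers and let $P\in\mathbb{E}=\mathbb{R}[X_1,\dots,X_n]_d$ be a homogeneous polynomial of degree $d$ in $n$ variables. The distance from $P$ to the real discriminant $\Delta$ for the Bombieri norm is $$\mathrm{dist}(P,\Delta)=\min_{x\in\mathcal{S}^{n-1}}\sqrt{P(x)^2+\frac{\|\nabla^TP(x)\|^2}{d}}.$$
   Context: $\mathcal{S}^{n-1}$ is the unit sphere of $\mathbb{R}^n$. The Bombieri norm on $\mathbb{E}$ is the norm of the scalar product for which distinct monomials are orthogonal and $\|x^\alpha\|^2=\alpha!/d!$ for $|\alpha|=d$ (where $\alpha!=\prod_i\alpha_i!$). The real discriminant $\Delta\subset\mathbb{E}$ is the set of polynomials $Q\in\mathbb{E}$ for which there is $x\in\mathcal{S}^{n-1}$ with $Q(x)=0$ and $\nabla Q(x)=0$; $\mathrm{dist}(P,\Delta)=\inf_{Q\in\Delta}\|P-Q\|$. For $x\in\mathcal{S}^{n-1}$, $\nabla^TP(x)=\nabla P(x)-\langle x\mid\nabla P(x)\rangle x$ is the component of the gradient tangent to the sphere, with Euclidean norm $\|\nabla^TP(x)\|$. *)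

theory Defs
  imports "HOL-Analysis.Analysis" "HOL-Library.Poly_Mapping"
begin

text \<open>
  Polynomials are elements of the monoid algebra: a monomial is an exponent vector
  \<open>'n \<Rightarrow>\<^sub>0 nat\<close>, and a polynomial is a finitely supported family of real coefficients
  indexed by monomials. The number of variables is \<open>CARD('n)\<close>.
\<close>

type_synonym 'n real_mpoly = "('n \<Rightarrow>\<^sub>0 nat) \<Rightarrow>\<^sub>0 real"

definition monom_degree :: "('n::finite \<Rightarrow>\<^sub>0 nat) \<Rightarrow> nat" where
  "monom_degree \<alpha> = (\<Sum>i\<in>UNIV. Poly_Mapping.lookup \<alpha> i)"

definition monom_fact :: "('n::finite \<Rightarrow>\<^sub>0 nat) \<Rightarrow> nat" where
  "monom_fact \<alpha> = (\<Prod>i\<in>UNIV. fact (Poly_Mapping.lookup \<alpha> i))"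

definition mpoly_eval :: "'n::finite real_mpoly \<Rightarrow> real ^ 'n \<Rightarrow> real" where
  "mpoly_eval P x = (\<Sum>\<alpha>\<in>Poly_Mapping.keys P. Poly_Mapping.lookup P \<alpha> *
    (\<Prod>i\<in>UNIV. (x $ i) ^ Poly_Mapping.lookup \<alpha> i))"

text \<open>As usual, the zero polynomial counts as homogeneous of every degree.\<close>

definition homogeneous_polys :: "nat \<Rightarrow> 'n::finite real_mpoly set" where
  "homogeneous_polys d = {P. \<forall>\<alpha>\<in>Poly_Mapping.keys P. monom_degree \<alpha> = d}"

text \<open>
  The bilinear extension of \<open>\<langle>X\<^sup>\<alpha>, X\<^sup>\<beta>\<rangle> = \<alpha>! / d!\<close> if \<open>\<alpha> = \<beta>\<close> and \<open>0\<close> otherwise.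
  Monomials outside \<open>keys Q\<close> contribute \<open>0\<close>, so summing over \<open>keys P\<close> suffices.
  Only meaningful on \<open>homogeneous_polys d\<close>.
\<close>

definition bombieri_inner :: "nat \<Rightarrow> 'n::finite real_mpoly \<Rightarrow> 'n real_mpoly \<Rightarrow> real" where
  "bombieri_inner d P Q =
     (\<Sum>\<alpha>\<in>Poly_Mapping.keys P. real (monom_fact \<alpha>) / fact d *
        (Poly_Mapping.lookup P \<alpha> * Poly_Mapping.lookup Q \<alpha>))"

definition bombieri_norm :: "nat \<Rightarrow> 'n::finite real_mpoly \<Rightarrow> real" where
  "bombieri_norm d P = sqrt (bombieri_inner d P P)"

definition gradient :: "('a::real_inner \<Rightarrow> real) \<Rightarrow> 'a \<Rightarrow> 'a" where
  "gradient f x = (THE D. GDERIV f x :> D)"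

definition tangential_gradient :: "('a::real_inner \<Rightarrow> real) \<Rightarrow> 'a \<Rightarrow> 'a" where
  "tangential_gradient f x = gradient f x - (x \<bullet> gradient f x) *\<^sub>R x"

definition real_discriminant :: "nat \<Rightarrow> 'n::finite real_mpoly set" where
  "real_discriminant d =
     {Q \<in> homogeneous_polys d.
        \<exists>x\<in>sphere 0 1. mpoly_eval Q x = 0 \<and> gradient (mpoly_eval Q) x = 0}"

definition bombieri_infdist :: "nat \<Rightarrow> 'n::finite real_mpoly \<Rightarrow> 'n real_mpoly set \<Rightarrow> real" where
  "bombieri_infdist d P A = (INF Q\<in>A. bombieri_norm d (P - Q))"

text \<open>
  The definite description in \<open>gradient\<close> and the infimum in \<open>bombieri_infdist\<close>
  are well-defined where they are used: polynomials have gradients everywhere, and the distances to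
  the discriminant, which contains \<open>0\<close>, form a nonempty set bounded below.
\<close>

lemma gradient_eqI:
  assumes "GDERIV f x :> D"
  shows "gradient f x = D"
  unfolding gradient_def
proof (rule the_equality)
  fix E assume "GDERIV f x :> E"
  with assms have "(\<lambda>h. h \<bullet> E) = (\<lambda>h. h \<bullet> D)"
    unfolding gderiv_def by (rule has_derivative_unique[rotated])
  then have "h \<bullet> (E - D) = 0" for h
    by (metis inner_diff_right right_minus_eq)
  then show "E = D"
    by (metis inner_eq_zero_iff right_minus_eq)
qed (rule assms)

lemma GDERIV_mpoly_eval:
  "GDERIV (mpoly_eval P) x :>
     (\<chi> i. \<Sum>\<alpha>\<in>Poly_Mapping.keys P. Poly_Mapping.lookup P \<alpha> *
        (real (Poly_Mapping.lookup \<alpha> i) * (x $ i) ^ (Poly_Mapping.lookup \<alpha> i - 1) *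
          (\<Prod>j\<in>UNIV - {i}. (x $ j) ^ Poly_Mapping.lookup \<alpha> j)))"
proof -
  have 1: "((\<lambda>x. \<Sum>\<alpha>\<in>Poly_Mapping.keys P. Poly_Mapping.lookup P \<alpha> *
    (\<Prod>i\<in>UNIV. (x $ i) ^ Poly_Mapping.lookup \<alpha> i)) has_derivative
    (\<lambda>h. \<Sum>\<alpha>\<in>Poly_Mapping.keys P. Poly_Mapping.lookup P \<alpha> *
       (\<Sum>i\<in>UNIV. (real (Poly_Mapping.lookup \<alpha> i) * (h $ i) * (x $ i) ^ (Poly_Mapping.lookup \<alpha> i - 1)) *
          (\<Prod>j\<in>UNIV - {i}. (x $ j) ^ Poly_Mapping.lookup \<alpha> j)))) (at x)"
    by (intro has_derivative_sum has_derivative_mult_right has_derivative_prod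
          has_derivative_power bounded_linear.has_derivative[OF bounded_linear_vec_nth]
          has_derivative_ident)
  show ?thesis
    unfolding gderiv_def mpoly_eval_def
    by (rule has_derivative_eq_rhs[OF 1], rule ext,
        simp add: inner_vec_def sum_distrib_left sum_distrib_right mult_ac,
        subst sum.swap, rule refl)
qed

lemma bombieri_inner_single:
  "bombieri_inner d (Poly_Mapping.single \<alpha> 1) (Poly_Mapping.single \<beta> 1) =
     (if \<alpha> = \<beta> then real (monom_fact \<alpha>) / fact d else 0)"
  by (simp add: bombieri_inner_def lookup_single when_def)

lemma bombieri_norm_nonneg: "bombieri_norm d P \<ge> 0"
  unfolding bombieri_norm_def bombieri_inner_def
  by (auto intro!: sum_nonneg)

lemma zero_in_real_discriminant: "0 \<in> (real_discriminant d :: 'n::finite real_mpoly set)"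
proof -
  obtain x :: "real ^ 'n" where "norm x = 1"
    using vector_choose_size zero_le_one by blast
  moreover have "gradient (mpoly_eval (0 :: 'n real_mpoly)) x = 0"
    using gradient_eqI[OF GDERIV_mpoly_eval[of 0 x]] by (simp add: vec_eq_iff)
  ultimately show ?thesis
    by (auto simp: real_discriminant_def homogeneous_polys_def mpoly_eval_def)
qed

lemma bdd_below_bombieri_norm: "bdd_below ((\<lambda>Q. bombieri_norm d (P - Q)) ` A)"
  by (intro bdd_belowI2[where m = 0] bombieri_norm_nonneg)

end

theory Submission
  imports Defs
begin

text \<open>
  For fixed \<open>x\<close>, the linear functional \<open>Q \<mapsto> c Q(x) + \<langle>v, \<nabla>Q(x)\<rangle> / d\<close> is represented, for the
  Bombieri scalar product, by the polynomial \<open>y \<mapsto> c \<langle>x, y\<rangle>\<^sup>d + \<langle>x, y\<rangle>\<^sup>d\<^sup>-\<^sup>1 \<langle>v, y\<rangle>\<close>. For \<open>c = P(x)\<close>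
  and \<open>v = \<nabla>\<^sup>TP(x)\<close> this representer \<open>R\<close> has the same value and gradient as \<open>P\<close> at \<open>x\<close>, so it is
  the orthogonal projection of \<open>P\<close> on the complement of the space of polynomials singular at \<open>x\<close>,
  and \<open>\<parallel>R\<parallel>\<^sup>2 = P(x)\<^sup>2 + \<parallel>\<nabla>\<^sup>TP(x)\<parallel>\<^sup>2 / d\<close>. The discriminant is the union of these spaces over the
  sphere, which is compact.
\<close>

section \<open>Monomials: values, gradients and degree\<close>

definition monom_eval :: "('n::finite \<Rightarrow>\<^sub>0 nat) \<Rightarrow> real ^ 'n \<Rightarrow> real" where
  "monom_eval \<alpha> x = (\<Prod>i\<in>UNIV. (x $ i) ^ Poly_Mapping.lookup \<alpha> i)"

text \<open>Copies the coordinates in \<open>GDERIV_mpoly_eval\<close>. The truncated exponent is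
  harmless, since an exponent 0 also makes the leading factor 0.\<close>

definition monom_gradient :: "('n::finite \<Rightarrow>\<^sub>0 nat) \<Rightarrow> real ^ 'n \<Rightarrow> real ^ 'n" where
  "monom_gradient \<alpha> x = (\<chi> i. real (Poly_Mapping.lookup \<alpha> i) *
     (x $ i) ^ (Poly_Mapping.lookup \<alpha> i - 1) *
     (\<Prod>j\<in>UNIV - {i}. (x $ j) ^ Poly_Mapping.lookup \<alpha> j))"

lemma GDERIV_monom_eval: "GDERIV (monom_eval \<alpha>) x :> monom_gradient \<alpha> x"
proof -
  have "mpoly_eval (Poly_Mapping.single \<alpha> 1) = monom_eval \<alpha>"
    by (simp add: mpoly_eval_def monom_eval_def fun_eq_iff)
  then show ?thesis
    using GDERIV_mpoly_eval[of "Poly_Mapping.single \<alpha> 1" x]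
    by (simp add: monom_gradient_def)
qed

lemma continuous_on_monom_gradient [continuous_intros]: "continuous_on A (monom_gradient \<alpha>)"
  unfolding monom_gradient_def by (intro continuous_intros)

text \<open>Euler's identity for one monomial: multiplying the i-th partial derivative by
  \<open>x $ i\<close> restores the monomial, with its i-th exponent as a factor.\<close>

lemma inner_monom_gradient:
  "x \<bullet> monom_gradient \<alpha> x = real (monom_degree \<alpha>) * monom_eval \<alpha> x"
proof -
  have "x $ i * monom_gradient \<alpha> x $ i = real (Poly_Mapping.lookup \<alpha> i) * monom_eval \<alpha> x" for i
  proof -
    have "real (Poly_Mapping.lookup \<alpha> i) * monom_eval \<alpha> x = real (Poly_Mapping.lookup \<alpha> i) *
        ((x $ i) ^ Poly_Mapping.lookup \<alpha> i *
          (\<Prod>j\<in>UNIV - {i}. (x $ j) ^ Poly_Mapping.lookup \<alpha> j))"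
      unfolding monom_eval_def by (subst prod.remove[of UNIV i]) auto
    then show ?thesis
      by (cases "Poly_Mapping.lookup \<alpha> i") (auto simp: monom_gradient_def)
  qed
  then show ?thesis
    by (simp add: inner_vec_def monom_degree_def sum_distrib_right)
qed

text \<open>Every exponent is bounded by the degree, and \<open>Poly_Mapping.lookup\<close> is
  injective, so these monomials embed into a finite function space.\<close>

lemma finite_monom_degree_eq: "finite {\<alpha> :: 'n::finite \<Rightarrow>\<^sub>0 nat. monom_degree \<alpha> = d}"
proof -
  have "Poly_Mapping.lookup \<alpha> i \<le> monom_degree \<alpha>" for \<alpha> :: "'n \<Rightarrow>\<^sub>0 nat" and i
    unfolding monom_degree_def by (rule member_le_sum) auto
  then have "Poly_Mapping.lookup ` {\<alpha> :: 'n \<Rightarrow>\<^sub>0 nat. monom_degree \<alpha> = d} \<subseteq> UNIV \<rightarrow>\<^sub>E {..d}"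
    by auto
  then have "finite (Poly_Mapping.lookup ` {\<alpha> :: 'n \<Rightarrow>\<^sub>0 nat. monom_degree \<alpha> = d})"
    by (rule finite_subset) (rule finite_PiE, simp_all)
  then show ?thesis
    by (rule finite_imageD) (simp add: inj_on_def lookup_inject)
qed

section \<open>Products of monomials and the multinomial theorem\<close>

lemma monom_degree_add: "monom_degree (\<alpha> + \<beta>) = monom_degree \<alpha> + monom_degree \<beta>"
  by (simp add: monom_degree_def lookup_add sum.distrib)

lemma monom_degree_single: "monom_degree (Poly_Mapping.single i k) = k"
  by (simp add: monom_degree_def lookup_single when_def)

lemma monom_eval_add: "monom_eval (\<alpha> + \<beta>) x = monom_eval \<alpha> x * monom_eval \<beta> x"
  by (simp add: monom_eval_def lookup_add power_add prod.distrib)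

lemma monom_eval_single: "monom_eval (Poly_Mapping.single i k) x = (x $ i) ^ k"
proof -
  have "monom_eval (Poly_Mapping.single i k) x = (\<Prod>j\<in>UNIV. if j = i then (x $ j) ^ k else 1)"
    unfolding monom_eval_def by (intro prod.cong) (auto simp: lookup_single when_def)
  then show ?thesis by simp
qed

lemma monom_fact_add_single:
  "monom_fact (\<alpha> + Poly_Mapping.single i 1) = Suc (Poly_Mapping.lookup \<alpha> i) * monom_fact \<alpha>"
proof -
  have "monom_fact (\<alpha> + Poly_Mapping.single i 1) =
      (\<Prod>j\<in>UNIV. (if j = i then Suc (Poly_Mapping.lookup \<alpha> j) else 1) *
        fact (Poly_Mapping.lookup \<alpha> j))"
    unfolding monom_fact_def
    by (intro prod.cong) (auto simp: lookup_add lookup_single when_def)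
  then show ?thesis
    by (simp add: prod.distrib monom_fact_def)
qed

lemma monom_fact_pos: "monom_fact \<alpha> > 0"
  by (simp add: monom_fact_def prod_pos)

text \<open>
  The induction counts the factors of each monomial:
  \<open>d \<Sum> z\<^sup>\<alpha> / \<alpha>! = \<Sum>\<^sub>i \<Sum> \<alpha>\<^sub>i z\<^sup>\<alpha> / \<alpha>!\<close>, and dividing by \<open>z\<^sub>i\<close> lowers the degree.
\<close>

lemma multinomial_theorem:
  fixes z :: "real ^ 'n::finite"
  shows "(\<Sum>\<alpha> | monom_degree \<alpha> = d. monom_eval \<alpha> z / monom_fact \<alpha>) =
    (\<Sum>i\<in>UNIV. z $ i) ^ d / fact d"
proof (induction d)
  case 0
  have "{\<alpha> :: 'n \<Rightarrow>\<^sub>0 nat. monom_degree \<alpha> = 0} = {0}"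
    by (auto simp: monom_degree_def poly_mapping_eq_iff fun_eq_iff)
  then show ?case
    by (simp add: monom_eval_def monom_fact_def)
next
  case (Suc d)
  let ?t = "\<lambda>\<alpha> :: 'n \<Rightarrow>\<^sub>0 nat. monom_eval \<alpha> z / monom_fact \<alpha>"
  have shift: "(\<Sum>\<alpha> | monom_degree \<alpha> = Suc d. real (Poly_Mapping.lookup \<alpha> i) * ?t \<alpha>) =
      z $ i * (\<Sum>\<alpha> | monom_degree \<alpha> = d. ?t \<alpha>)" for i
  proof -
    \<comment> \<open>Subtraction of exponents is truncated, so it is undone by addition only where
      the i-th exponent is positive.\<close>
    have sub: "\<alpha> - Poly_Mapping.single i 1 + Poly_Mapping.single i 1 = \<alpha>"
      if "Poly_Mapping.lookup \<alpha> i \<noteq> 0" for \<alpha> :: "'n \<Rightarrow>\<^sub>0 nat"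
      using that
      by (auto simp: poly_mapping_eq_iff fun_eq_iff lookup_add lookup_minus lookup_single when_def)
    \<comment> \<open>The new exponent of the i-th variable cancels the factor by which the
      factorial grows.\<close>
    have step: "real (Poly_Mapping.lookup (\<alpha> + Poly_Mapping.single i 1) i) *
        ?t (\<alpha> + Poly_Mapping.single i 1) = z $ i * ?t \<alpha>" for \<alpha>
    proof -
      have "?t (\<alpha> + Poly_Mapping.single i 1) =
          monom_eval \<alpha> z * z $ i / (real (Suc (Poly_Mapping.lookup \<alpha> i)) * monom_fact \<alpha>)"
        unfolding monom_fact_add_single monom_eval_add monom_eval_single
        by (simp add: distrib_right)
      then show ?thesis
        by (simp add: lookup_add field_simps del: of_nat_Suc)
    qed
    \<comment> \<open>Terms with i-th exponent 0 vanish. On the others, lowering that exponent is a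
      bijection onto the monomials of degree \<open>d\<close>.\<close>
    have "(\<Sum>\<alpha> | monom_degree \<alpha> = Suc d. real (Poly_Mapping.lookup \<alpha> i) * ?t \<alpha>) =
        (\<Sum>\<alpha> | monom_degree \<alpha> = Suc d \<and> Poly_Mapping.lookup \<alpha> i \<noteq> 0.
          real (Poly_Mapping.lookup \<alpha> i) * ?t \<alpha>)"
      by (intro sum.mono_neutral_right finite_monom_degree_eq) auto
    also have "\<dots> = (\<Sum>\<alpha> | monom_degree \<alpha> = d. z $ i * ?t \<alpha>)"
    proof (rule sum.reindex_bij_witness[where i = "\<lambda>\<alpha>. \<alpha> + Poly_Mapping.single i 1" and
          j = "\<lambda>\<alpha>. \<alpha> - Poly_Mapping.single i 1"])
      fix \<alpha> :: "'n \<Rightarrow>\<^sub>0 nat"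
      assume \<alpha>: "\<alpha> \<in> {\<alpha>. monom_degree \<alpha> = Suc d \<and> Poly_Mapping.lookup \<alpha> i \<noteq> 0}"
      show "\<alpha> - Poly_Mapping.single i 1 + Poly_Mapping.single i 1 = \<alpha>"
        using \<alpha> sub by simp
      have "monom_degree (\<alpha> - Poly_Mapping.single i 1) + 1 = monom_degree \<alpha>"
        using sub[of \<alpha>] \<alpha>
          monom_degree_add[of "\<alpha> - Poly_Mapping.single i 1" "Poly_Mapping.single i 1"]
        by (simp add: monom_degree_single)
      then show "\<alpha> - Poly_Mapping.single i 1 \<in> {\<alpha>. monom_degree \<alpha> = d}"
        using \<alpha> by simp
      show "z $ i * ?t (\<alpha> - Poly_Mapping.single i 1) = real (Poly_Mapping.lookup \<alpha> i) * ?t \<alpha>"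
        using step[of "\<alpha> - Poly_Mapping.single i 1"] sub[of \<alpha>] \<alpha> by simp
    next
      fix \<alpha> :: "'n \<Rightarrow>\<^sub>0 nat"
      assume \<alpha>: "\<alpha> \<in> {\<alpha>. monom_degree \<alpha> = d}"
      show "\<alpha> + Poly_Mapping.single i 1 - Poly_Mapping.single i 1 = \<alpha>" by simp
      show "\<alpha> + Poly_Mapping.single i 1 \<in>
          {\<alpha>. monom_degree \<alpha> = Suc d \<and> Poly_Mapping.lookup \<alpha> i \<noteq> 0}"
        using \<alpha> by (simp add: monom_degree_add monom_degree_single lookup_add)
    qed
    finally show ?thesis by (simp add: sum_distrib_left)
  qed
  have "real (Suc d) * (\<Sum>\<alpha> | monom_degree \<alpha> = Suc d. ?t \<alpha>) =
      (\<Sum>\<alpha> | monom_degree \<alpha> = Suc d. \<Sum>i\<in>UNIV. real (Poly_Mapping.lookup \<alpha> i) * ?t \<alpha>)"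
    unfolding sum_distrib_left
  proof (rule sum.cong[OF refl])
    fix \<alpha> :: "'n \<Rightarrow>\<^sub>0 nat"
    assume "\<alpha> \<in> {\<alpha>. monom_degree \<alpha> = Suc d}"
    then have "real (Suc d) = (\<Sum>i\<in>UNIV. real (Poly_Mapping.lookup \<alpha> i))"
      by (simp add: monom_degree_def flip: of_nat_sum)
    then show "real (Suc d) * ?t \<alpha> = (\<Sum>i\<in>UNIV. real (Poly_Mapping.lookup \<alpha> i) * ?t \<alpha>)"
      by (simp only: sum_distrib_right)
  qed
  also have "\<dots> = (\<Sum>i\<in>UNIV. z $ i) * (\<Sum>\<alpha> | monom_degree \<alpha> = d. ?t \<alpha>)"
    by (subst sum.swap) (simp only: shift sum_distrib_right)
  also have "\<dots> = (\<Sum>i\<in>UNIV. z $ i) ^ Suc d / fact d"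
    by (simp only: Suc.IH power_Suc times_divide_eq_right)
  finally have "(\<Sum>\<alpha> | monom_degree \<alpha> = Suc d. ?t \<alpha>) =
      (\<Sum>i\<in>UNIV. z $ i) ^ Suc d / fact d / real (Suc d)"
    by (simp only: nonzero_eq_divide_eq of_nat_Suc) (simp add: mult.commute)
  then show ?case
    by (simp add: mult.commute)
qed

section \<open>The reproducing kernel of the Bombieri product\<close>

text \<open>The multinomial theorem at the coordinatewise product of \<open>x\<close> and
  \<open>y\<close>, whose coordinates sum to \<open>x \<bullet> y\<close>.\<close>

lemma sum_monom_eval_mult:
  fixes x y :: "real ^ 'n::finite"
  shows "(\<Sum>\<alpha> | monom_degree \<alpha> = d. fact d / monom_fact \<alpha> * monom_eval \<alpha> y * monom_eval \<alpha> x) =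
    (x \<bullet> y) ^ d"
proof -
  have "monom_eval \<alpha> (\<chi> i. x $ i * y $ i) = monom_eval \<alpha> y * monom_eval \<alpha> x" for \<alpha>
    by (simp add: monom_eval_def power_mult_distrib prod.distrib)
  then show ?thesis
    using arg_cong[OF multinomial_theorem[of "\<chi> i. x $ i * y $ i" d], of "\<lambda>t. fact d * t"]
    by (simp add: sum_distrib_left inner_vec_def mult.assoc)
qed

lemma GDERIV_inner_power:
  "GDERIV (\<lambda>x. (x \<bullet> y) ^ d) x :> (real d * (x \<bullet> y) ^ (d - 1)) *\<^sub>R y"
  unfolding gderiv_def
  by (rule has_derivative_eq_rhs, (rule derivative_intros)+)
    (simp add: fun_eq_iff mult_ac)

text \<open>Differentiating \<open>sum_monom_eval_mult\<close> in \<open>x\<close> computes the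
  gradient of one function in two ways; gradients are unique.\<close>

lemma sum_monom_gradient_mult:
  fixes x y :: "real ^ 'n::finite"
  shows "(\<Sum>\<alpha> | monom_degree \<alpha> = d.
      (fact d / monom_fact \<alpha> * monom_eval \<alpha> y) *\<^sub>R monom_gradient \<alpha> x) =
    (real d * (x \<bullet> y) ^ (d - 1)) *\<^sub>R y"
    (is "?G = _")
proof -
  have "((\<lambda>x. \<Sum>\<alpha> | monom_degree \<alpha> = d. fact d / monom_fact \<alpha> * monom_eval \<alpha> y *
      monom_eval \<alpha> x) has_derivative
      (\<lambda>h. \<Sum>\<alpha> | monom_degree \<alpha> = d. fact d / monom_fact \<alpha> * monom_eval \<alpha> y *
        (h \<bullet> monom_gradient \<alpha> x))) (at x)"
    by (intro has_derivative_sum has_derivative_mult_right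
        GDERIV_monom_eval[unfolded gderiv_def])
  then have "GDERIV (\<lambda>x. (x \<bullet> y) ^ d) x :> ?G"
    by (simp only: gderiv_def sum_monom_eval_mult inner_sum_right inner_scaleR_right)
  then show ?thesis
    using gradient_eqI[OF GDERIV_inner_power[of y d x]] by (simp only: gradient_eqI)
qed

section \<open>Homogeneous polynomials as sums over a fixed set of monomials\<close>

text \<open>Replaces the support of \<open>P\<close> by an index set that depends on
  \<open>d\<close> alone, so that sums for different polynomials can be combined term by
  term.\<close>

lemma sum_keys_homogeneous:
  fixes P :: "'n::finite real_mpoly"
  assumes "P \<in> homogeneous_polys d" and "\<And>\<alpha>. Poly_Mapping.lookup P \<alpha> = 0 \<Longrightarrow> f \<alpha> = 0"
  shows "(\<Sum>\<alpha>\<in>Poly_Mapping.keys P. f \<alpha>) = (\<Sum>\<alpha> | monom_degree \<alpha> = d. f \<alpha>)"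
  using assms
  by (intro sum.mono_neutral_left finite_monom_degree_eq)
    (auto simp: homogeneous_polys_def in_keys_iff)

lemma homogeneous_polys_diff:
  "P \<in> homogeneous_polys d \<Longrightarrow> Q \<in> homogeneous_polys d \<Longrightarrow> P - Q \<in> homogeneous_polys d"
  by (auto simp: homogeneous_polys_def in_keys_iff lookup_minus)

lemma mpoly_eval_homogeneous:
  assumes "P \<in> homogeneous_polys d"
  shows "mpoly_eval P x = (\<Sum>\<alpha> | monom_degree \<alpha> = d. Poly_Mapping.lookup P \<alpha> * monom_eval \<alpha> x)"
  unfolding mpoly_eval_def monom_eval_def by (rule sum_keys_homogeneous[OF assms]) simp

lemma gradient_mpoly_eval:
  "gradient (mpoly_eval P) x =
    (\<Sum>\<alpha>\<in>Poly_Mapping.keys P. Poly_Mapping.lookup P \<alpha> *\<^sub>R monom_gradient \<alpha> x)"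
  unfolding gradient_eqI[OF GDERIV_mpoly_eval]
  by (simp add: vec_eq_iff monom_gradient_def)

lemma gradient_mpoly_eval_homogeneous:
  assumes "P \<in> homogeneous_polys d"
  shows "gradient (mpoly_eval P) x =
    (\<Sum>\<alpha> | monom_degree \<alpha> = d. Poly_Mapping.lookup P \<alpha> *\<^sub>R monom_gradient \<alpha> x)"
  unfolding gradient_mpoly_eval by (rule sum_keys_homogeneous[OF assms]) simp

lemma bombieri_inner_homogeneous:
  assumes "P \<in> homogeneous_polys d"
  shows "bombieri_inner d P Q = (\<Sum>\<alpha> | monom_degree \<alpha> = d.
    real (monom_fact \<alpha>) / fact d * (Poly_Mapping.lookup P \<alpha> * Poly_Mapping.lookup Q \<alpha>))"
  unfolding bombieri_inner_def by (rule sum_keys_homogeneous[OF assms]) simp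

lemma mpoly_eval_diff:
  assumes "P \<in> homogeneous_polys d" and "Q \<in> homogeneous_polys d"
  shows "mpoly_eval (P - Q) x = mpoly_eval P x - mpoly_eval Q x"
  by (simp add: assms homogeneous_polys_diff mpoly_eval_homogeneous[of _ d] lookup_minus
      left_diff_distrib sum_subtractf)

lemma gradient_mpoly_eval_diff:
  assumes "P \<in> homogeneous_polys d" and "Q \<in> homogeneous_polys d"
  shows "gradient (mpoly_eval (P - Q)) x = gradient (mpoly_eval P) x - gradient (mpoly_eval Q) x"
  by (simp add: assms homogeneous_polys_diff gradient_mpoly_eval_homogeneous[of _ d] lookup_minus
      scaleR_left_diff_distrib sum_subtractf)

lemma euler_homogeneous:
  assumes "P \<in> homogeneous_polys d"
  shows "x \<bullet> gradient (mpoly_eval P) x = real d * mpoly_eval P x"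
  unfolding gradient_mpoly_eval_homogeneous[OF assms] mpoly_eval_homogeneous[OF assms]
    inner_sum_right sum_distrib_left
  by (intro sum.cong) (auto simp: inner_monom_gradient)

text \<open>The hypothesis says that \<open>P - Q\<close> is orthogonal to \<open>Q\<close>, so
  \<open>Q\<close> is an orthogonal projection of \<open>P\<close> and cannot be longer.\<close>

lemma bombieri_norm_le_of_inner_eq:
  fixes P Q :: "'n::finite real_mpoly"
  assumes P: "P \<in> homogeneous_polys d" and Q: "Q \<in> homogeneous_polys d"
    and eq: "bombieri_inner d P Q = bombieri_inner d Q Q"
  shows "bombieri_norm d Q \<le> bombieri_norm d P"
proof -
  \<comment> \<open>This is the expanded form of the squared norm of \<open>P - Q\<close> being
    nonnegative, checked for each coefficient. By \<open>eq\<close> the left side is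
    \<open>bombieri_inner d Q Q\<close>.\<close>
  have "2 * bombieri_inner d P Q - bombieri_inner d Q Q \<le> bombieri_inner d P P"
    unfolding bombieri_inner_homogeneous[OF P] bombieri_inner_homogeneous[OF Q]
      sum_distrib_left sum_subtractf[symmetric]
  proof (rule sum_mono)
    fix \<alpha> :: "'n \<Rightarrow>\<^sub>0 nat"
    let ?w = "real (monom_fact \<alpha>) / fact d"
    let ?p = "Poly_Mapping.lookup P \<alpha>" and ?q = "Poly_Mapping.lookup Q \<alpha>"
    have "0 \<le> ?w * (?p - ?q)\<^sup>2" by simp
    then show "2 * (?w * (?p * ?q)) - ?w * (?q * ?q) \<le> ?w * (?p * ?p)"
      by (simp add: power2_eq_square algebra_simps)
  qed
  then show ?thesis
    unfolding bombieri_norm_def eq by simp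
qed

section \<open>Representing values and gradients at a point\<close>

text \<open>The coefficient at \<alpha> is the value of the functional on that monomial, divided by
  the squared Bombieri norm \<open>monom_fact \<alpha> / fact d\<close> of the monomial.\<close>

definition jet_representer :: "nat \<Rightarrow> real ^ 'n \<Rightarrow> real \<Rightarrow> real ^ 'n \<Rightarrow> 'n::finite real_mpoly" where
  "jet_representer d x c v = (\<Sum>\<alpha> | monom_degree \<alpha> = d. Poly_Mapping.single \<alpha>
     (fact d / monom_fact \<alpha> * (c * monom_eval \<alpha> x + v \<bullet> monom_gradient \<alpha> x / d)))"

lemma lookup_jet_representer:
  "Poly_Mapping.lookup (jet_representer d x c v) \<alpha> = (if monom_degree \<alpha> = d
     then fact d / monom_fact \<alpha> * (c * monom_eval \<alpha> x + v \<bullet> monom_gradient \<alpha> x / d) else 0)"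
  by (simp add: jet_representer_def lookup_sum lookup_single when_def finite_monom_degree_eq)

lemma jet_representer_homogeneous: "jet_representer d x c v \<in> homogeneous_polys d"
  by (auto simp: homogeneous_polys_def in_keys_iff lookup_jet_representer split: if_splits)

text \<open>The weight of the scalar product cancels the normalisation of each coefficient, which
  leaves the functional expanded by linearity.\<close>

lemma bombieri_inner_jet_representer:
  fixes P :: "'n::finite real_mpoly"
  assumes "P \<in> homogeneous_polys d"
  shows "bombieri_inner d P (jet_representer d x c v) =
    c * mpoly_eval P x + v \<bullet> gradient (mpoly_eval P) x / d"
proof -
  have "bombieri_inner d P (jet_representer d x c v) = (\<Sum>\<alpha> | monom_degree \<alpha> = d.
      c * (Poly_Mapping.lookup P \<alpha> * monom_eval \<alpha> x) +
      v \<bullet> (Poly_Mapping.lookup P \<alpha> *\<^sub>R monom_gradient \<alpha> x) / d)"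
    unfolding bombieri_inner_homogeneous[OF assms]
  proof (rule sum.cong[OF refl])
    fix \<alpha> :: "'n \<Rightarrow>\<^sub>0 nat"
    assume "\<alpha> \<in> {\<alpha>. monom_degree \<alpha> = d}"
    then show "real (monom_fact \<alpha>) / fact d *
        (Poly_Mapping.lookup P \<alpha> * Poly_Mapping.lookup (jet_representer d x c v) \<alpha>) =
      c * (Poly_Mapping.lookup P \<alpha> * monom_eval \<alpha> x) +
      v \<bullet> (Poly_Mapping.lookup P \<alpha> *\<^sub>R monom_gradient \<alpha> x) / d"
      using monom_fact_pos[of \<alpha>] by (simp add: lookup_jet_representer) (simp add: algebra_simps)
  qed
  then show ?thesis
    by (simp add: mpoly_eval_homogeneous[OF assms] gradient_mpoly_eval_homogeneous[OF assms]
        sum.distrib sum_distrib_left inner_sum_right sum_divide_distrib)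
qed

text \<open>The two kernel identities sum the series; the factor \<open>d\<close> from
  differentiating the power cancels the division by \<open>d\<close>.\<close>

lemma mpoly_eval_jet_representer:
  assumes "d > 0"
  shows "mpoly_eval (jet_representer d x c v) y =
    c * (x \<bullet> y) ^ d + (x \<bullet> y) ^ (d - 1) * (v \<bullet> y)"
proof -
  have "mpoly_eval (jet_representer d x c v) y =
      c * (\<Sum>\<alpha> | monom_degree \<alpha> = d. fact d / monom_fact \<alpha> * monom_eval \<alpha> y * monom_eval \<alpha> x) +
      v \<bullet> (\<Sum>\<alpha> | monom_degree \<alpha> = d.
        (fact d / monom_fact \<alpha> * monom_eval \<alpha> y) *\<^sub>R monom_gradient \<alpha> x) / d"
    unfolding mpoly_eval_homogeneous[OF jet_representer_homogeneous]
    by (simp add: lookup_jet_representer sum_distrib_left inner_sum_right sum_divide_distrib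
        algebra_simps flip: sum.distrib)
  then show ?thesis
    unfolding sum_monom_eval_mult sum_monom_gradient_mult using assms by simp
qed

text \<open>At \<open>y = x\<close> one has \<open>x \<bullet> y = 1\<close> and
  \<open>v \<bullet> y = 0\<close>. Hence the second summand vanishes there, and in its product rule
  only the derivative of \<open>v \<bullet> y\<close> survives.\<close>

lemma jet_representer_at_base_point:
  assumes "d > 1" and "norm x = 1" and "x \<bullet> v = 0"
  shows "mpoly_eval (jet_representer d x c v) x = c"
    and "gradient (mpoly_eval (jet_representer d x c v)) x = (real d * c) *\<^sub>R x + v"
proof -
  have xx: "x \<bullet> x = 1" and vx: "v \<bullet> x = 0"
    using assms by (simp_all add: dot_square_norm inner_commute)
  show "mpoly_eval (jet_representer d x c v) x = c"
    using assms(1) by (simp add: mpoly_eval_jet_representer xx vx)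
  have "GDERIV (\<lambda>y. c * (x \<bullet> y) ^ d + (x \<bullet> y) ^ (d - 1) * (v \<bullet> y)) x :>
      (real d * c) *\<^sub>R x + v"
    unfolding gderiv_def
    by (rule has_derivative_eq_rhs, (rule derivative_intros)+)
      (simp add: fun_eq_iff xx vx algebra_simps inner_commute)
  moreover have "mpoly_eval (jet_representer d x c v) =
      (\<lambda>y. c * (x \<bullet> y) ^ d + (x \<bullet> y) ^ (d - 1) * (v \<bullet> y))"
    using assms(1) by (simp add: fun_eq_iff mpoly_eval_jet_representer)
  ultimately show "gradient (mpoly_eval (jet_representer d x c v)) x = (real d * c) *\<^sub>R x + v"
    by (simp add: gradient_eqI)
qed

section \<open>Tangential gradients and the distance formula\<close>

text \<open>Euler's identity turns the radial coefficient into \<open>d\<close> times the value, so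
  the value and the tangential gradient determine the full gradient.\<close>

lemma gradient_eq_tangential:
  assumes "P \<in> homogeneous_polys d"
  shows "gradient (mpoly_eval P) x =
    (real d * mpoly_eval P x) *\<^sub>R x + tangential_gradient (mpoly_eval P) x"
  unfolding tangential_gradient_def by (simp add: euler_homogeneous[OF assms])

lemma inner_tangential_gradient:
  "norm x = 1 \<Longrightarrow> x \<bullet> tangential_gradient f x = 0"
  by (simp add: tangential_gradient_def inner_diff_right dot_square_norm)

lemma continuous_on_tangential_gradient:
  "continuous_on A (tangential_gradient (mpoly_eval P))"
  unfolding tangential_gradient_def gradient_mpoly_eval by (intro continuous_intros)

lemma continuous_on_mpoly_eval: "continuous_on A (mpoly_eval P)"
  unfolding mpoly_eval_def by (intro continuous_intros)

theorem theorem5p1: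
  fixes P :: "'n::finite real_mpoly" and d :: nat
  assumes "CARD('n) > 1" and "d > 1" and "P \<in> homogeneous_polys d"
  defines "F \<equiv> \<lambda>x :: real ^ 'n.
    sqrt ((mpoly_eval P x)\<^sup>2 + (norm (tangential_gradient (mpoly_eval P) x))\<^sup>2 / real d)"
  shows "(\<exists>x\<in>sphere 0 1. bombieri_infdist d P (real_discriminant d) = F x) \<and>
         (\<forall>x\<in>sphere 0 1. bombieri_infdist d P (real_discriminant d) \<le> F x)"
proof -
  define R where "R x = jet_representer d x (mpoly_eval P x) (tangential_gradient (mpoly_eval P) x)"
    for x
  have R: "R x \<in> homogeneous_polys d" for x
    by (simp add: R_def jet_representer_homogeneous)
  \<comment> \<open>Pairing with \<open>R x\<close> sees only the value and gradient of
    \<open>S\<close> at \<open>x\<close>. The radial part of that gradient is orthogonal to the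
    tangential gradient, which leaves the square of \<open>F x\<close>. This serves for
    \<open>S = R x\<close> and for \<open>S = P - Q\<close>.\<close>
  have R_inner: "bombieri_inner d S (R x) = (F x)\<^sup>2"
    if "S \<in> homogeneous_polys d" and "norm x = 1" and "mpoly_eval S x = mpoly_eval P x"
      and "gradient (mpoly_eval S) x = gradient (mpoly_eval P) x" for S x
    using that inner_tangential_gradient[OF that(2), of "mpoly_eval P"]
    by (simp add: R_def bombieri_inner_jet_representer gradient_eq_tangential[OF assms(3)]
        inner_add_right inner_commute F_def dot_square_norm power2_eq_square)
  have R_jet: "mpoly_eval (R x) x = mpoly_eval P x"
    "gradient (mpoly_eval (R x)) x = gradient (mpoly_eval P) x" if "norm x = 1" for x
    using jet_representer_at_base_point[OF assms(2) that inner_tangential_gradient[OF that]]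
    by (simp_all add: R_def gradient_eq_tangential[OF assms(3)])
  have R_norm: "bombieri_norm d (R x) = F x" if "norm x = 1" for x
    using R_inner[OF R that R_jet[OF that]] by (simp add: bombieri_norm_def F_def)
  have upper: "bombieri_infdist d P (real_discriminant d) \<le> F x" if x: "x \<in> sphere 0 1" for x
  proof -
    \<comment> \<open>Removing \<open>R x\<close> from \<open>P\<close> cancels value and gradient
      at \<open>x\<close>; this singular polynomial lies at distance \<open>F x\<close> from
      \<open>P\<close>.\<close>
    have "P - R x \<in> real_discriminant d"
      using x R_jet[of x] assms(3) R[of x]
      by (auto simp: real_discriminant_def homogeneous_polys_diff mpoly_eval_diff[of _ d]
          gradient_mpoly_eval_diff[of _ d] intro!: bexI[of _ x])
    then have "bombieri_infdist d P (real_discriminant d) \<le> bombieri_norm d (P - (P - R x))"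
      unfolding bombieri_infdist_def by (intro cINF_lower bdd_below_bombieri_norm)
    then show ?thesis
      using x R_norm[of x] by simp
  qed
  have lower: "\<exists>x\<in>sphere 0 1. F x \<le> bombieri_norm d (P - Q)" if "Q \<in> real_discriminant d" for Q
  proof -
    from that obtain x where Q: "Q \<in> homogeneous_polys d" and x: "norm x = 1"
      and Q0: "mpoly_eval Q x = 0" "gradient (mpoly_eval Q) x = 0"
      by (auto simp: real_discriminant_def)
    \<comment> \<open>Since \<open>Q\<close> is singular at \<open>x\<close>, \<open>P - Q\<close>
      has the same value and gradient there as \<open>P\<close>. Both sides therefore equal the
      square of \<open>F x\<close>.\<close>
    have "bombieri_inner d (P - Q) (R x) = bombieri_inner d (R x) (R x)"
      using R_inner[OF R x R_jet[OF x]] Q0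
        R_inner[OF homogeneous_polys_diff[OF assms(3) Q] x]
      by (simp add: mpoly_eval_diff[OF assms(3) Q] gradient_mpoly_eval_diff[OF assms(3) Q])
    then have "F x \<le> bombieri_norm d (P - Q)"
      using bombieri_norm_le_of_inner_eq[OF homogeneous_polys_diff[OF assms(3) Q] R] R_norm[OF x]
      by metis
    with x show ?thesis by auto
  qed
  have "continuous_on (sphere 0 1) F"
    unfolding F_def
    by (intro continuous_intros continuous_on_mpoly_eval continuous_on_tangential_gradient)
      (use assms(2) in simp)
  moreover have "sphere (0 :: real ^ 'n) 1 \<noteq> {}"
    by simp
  \<comment> \<open>The point given by \<open>lower\<close> varies with \<open>Q\<close>; a minimum
    of \<open>F\<close> on the compact sphere bounds all these distances from below at once.\<close>
  ultimately obtain x where x: "x \<in> sphere 0 1" and min: "\<And>y. y \<in> sphere 0 1 \<Longrightarrow> F x \<le> F y"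
    using continuous_attains_inf[OF compact_sphere] by metis
  have "F x \<le> bombieri_infdist d P (real_discriminant d)"
    unfolding bombieri_infdist_def
  proof (rule cINF_greatest)
    show "real_discriminant d \<noteq> ({} :: 'n real_mpoly set)"
      using zero_in_real_discriminant by blast
  qed (use lower min order_trans in blast)
  with upper x show ?thesis
    by (metis order_antisym)
qed

end
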